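(* Let $n\ge 0$ be an integer (an ordinary natural number), and let $$f(z)=a_0+a_1z+\dots+a_nz^n=a_n\prod_{1\le i\le n}(z-r_i)$$ be a polynomial with coefficients $a_i\in\mathbb{C}$, $a_n\neq 0$, with roots $r_1,\dots,r_n\in\mathbb{C}$ (possibly with duplication). Let $$g(z)=b_0+b_1z+\dots+b_nz^n=b_n\prod_{1\le i\le n}(z-s_i)$$ be a polynomial with coefficients $b_i\in{}^{*}\mathbb{C}$ and roots $s_1,\dots,s_n\in{}^{*}\mathbb{C}$ (possibly with duplication). If $g(z)$ is an infinitesimal deformation of $f(z)$, then $g(z)$ is infinitesimally aligned with $f(z)$.
   Context: Nonstandard setting: ${}^{*}\mathbb{C}$ is an algebraically closed field extending $\mathbb{C}$. The usual norm $|\cdot|$ on $\mathbb{C}$ extends to a norm on ${}^{*}\mathbb{C}$ with values in an ordered field extension of $\mathbb{R}$, satisfying the usual properties of an absolute value (nonnegativity, vanishing only at $0$, multiplicativity, triangle inequality). Elements of $\mathbb{C}$ are called standard. An element $z\in{}^{*}\mathbb{C}$ is infinitesimal if $|z|<1/m$ for every positive integer $m$ (so $0$ is infinitesimal); nonzero infinitesimals are assumed to exist. An element $z$ is finite if $|z|<m$ for some integer $m$, and infinite otherwise; the infinite elements are exactly the reciprocals of nonzero infinitesimals. It is assumed that every finite $z\in{}^{*}\mathbb{C}$ differs by an infinitesimal from a unique element of $\mathbb{C}$, denoted ${}^{\circ}z$ and called the standard part of $z$. The standard part map is a ring homomorphism from the finite elements onto $\mathbb{C}$, fixes $\mathbb{C}$,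 and satisfies ${}^{\circ}(a/b)={}^{\circ}a/{}^{\circ}b$ for finite $a,b$ with $b$ not infinitesimal. Write $a\approx b$ if $a-b$ is infinitesimal. Definitions: Let $f(z)=\sum_{i=0}^n a_iz^i$ with $a_i\in\mathbb{C}$, $a_n\ne0$, and $g(z)=\sum_{i=0}^n b_iz^i$ with $b_i\in{}^{*}\mathbb{C}$. The polynomial $g(z)$ is an infinitesimal deformation of $f(z)$ if $a_i\approx b_i$ for each $i\in\{0,1,\dots,n\}$. The polynomial $g(z)$ is infinitesimally aligned with $f(z)$ if there are orderings $r_1,\dots,r_n$ of the (not necessarily distinct) roots of $f(z)$ and $s_1,\dots,s_n$ of the (not necessarily distinct) roots of $g(z)$, listed with multiplicity, such that $s_i\approx r_i$ for every $i\in\{1,\dots,n\}$. *)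

theory Defs
  imports Complex_Main "HOL-Computational_Algebra.Computational_Algebra"
begin

definition infinitesimal :: "('a \<Rightarrow> 'b::linordered_field) \<Rightarrow> 'a \<Rightarrow> bool" where
  "infinitesimal nrm z \<longleftrightarrow> (\<forall>m::nat. m > 0 \<longrightarrow> nrm z < 1 / of_nat m)"

definition finite_elt :: "('a \<Rightarrow> 'b::linordered_field) \<Rightarrow> 'a \<Rightarrow> bool" where
  "finite_elt nrm z \<longleftrightarrow> (\<exists>m::int. nrm z < of_int m)"

definition inf_close :: "('a::ab_group_add \<Rightarrow> 'b::linordered_field) \<Rightarrow> 'a \<Rightarrow> 'a \<Rightarrow> bool" where
  "inf_close nrm x y \<longleftrightarrow> infinitesimal nrm (x - y)"

text \<open>
  The type \<open>'a\<close> plays the role of the nonstandard complex numbers and \<open>'b\<close> that of the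
  ordered field in which the extended norm \<open>nrm\<close> takes its values. The inclusions
  of the standard numbers are the embeddings \<open>emb\<close> and \<open>remb\<close>; injectivity of \<open>emb\<close>
  follows from the homomorphism laws. The standard part of a finite \<open>z\<close> is the unique \<open>c\<close>
  of the last assumption; its ring homomorphism properties are consequences.
\<close>

locale nonstandard_complex =
  fixes emb :: "complex \<Rightarrow> 'a::alg_closed_field"
    and remb :: "real \<Rightarrow> 'b::linordered_field"
    and nrm :: "'a \<Rightarrow> 'b"
  assumes emb_1: "emb 1 = 1"
    and emb_add: "emb (x + y) = emb x + emb y"
    and emb_mult: "emb (x * y) = emb x * emb y"
    and remb_1: "remb 1 = 1"
    and remb_add: "remb (u + v) = remb u + remb v"
    and remb_mult: "remb (u * v) = remb u * remb v"
    and remb_strict_mono: "strict_mono remb"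
    and nrm_emb: "nrm (emb x) = remb (cmod x)"
    and nrm_nonneg: "0 \<le> nrm z"
    and nrm_eq_0_iff: "nrm z = 0 \<longleftrightarrow> z = 0"
    and nrm_mult: "nrm (z * w) = nrm z * nrm w"
    and nrm_triangle: "nrm (z + w) \<le> nrm z + nrm w"
    and ex_nonzero_infinitesimal: "\<exists>e. e \<noteq> 0 \<and> infinitesimal nrm e"
    and ex1_standard_part: "finite_elt nrm z \<Longrightarrow> \<exists>!c. inf_close nrm z (emb c)"

text \<open>
  In the following two definitions the number \<open>n\<close> of the informal notation is \<open>degree f\<close>;
  the polynomial \<open>g\<close> may a priori have smaller degree, as its coefficient at \<open>n\<close> is not
  required to be nonzero.
\<close>

definition infinitesimal_deformation ::
    "(complex \<Rightarrow> 'a::field) \<Rightarrow> ('a \<Rightarrow> 'b::linordered_field) \<Rightarrow> 'a poly \<Rightarrow> complex poly \<Rightarrow> bool" where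
  "infinitesimal_deformation emb nrm g f \<longleftrightarrow>
     f \<noteq> 0 \<and> degree g \<le> degree f \<and>
     (\<forall>i\<le>degree f. inf_close nrm (emb (coeff f i)) (coeff g i))"

text \<open>The zero polynomial is excluded since the library sets \<open>proots 0 = {#}\<close>.\<close>

definition root_ordering :: "'a::field poly \<Rightarrow> 'a list \<Rightarrow> bool" where
  "root_ordering p xs \<longleftrightarrow> p \<noteq> 0 \<and> mset xs = proots p"

definition infinitesimally_aligned ::
    "(complex \<Rightarrow> 'a::field) \<Rightarrow> ('a \<Rightarrow> 'b::linordered_field) \<Rightarrow> 'a poly \<Rightarrow> complex poly \<Rightarrow> bool" where
  "infinitesimally_aligned emb nrm g f \<longleftrightarrow>
     f \<noteq> 0 \<and> degree g \<le> degree f \<and>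
     (\<exists>rs ss. length rs = degree f \<and> length ss = degree f \<and>
        root_ordering f rs \<and> root_ordering g ss \<and>
        (\<forall>i<degree f. inf_close nrm (ss ! i) (emb (rs ! i))))"

end

theory Submission
  imports Defs
begin

text \<open>
  Taking standard parts is compatible with sums and products, so a factorization of \<open>g\<close>
  with finite roots can be pushed down to \<open>\<complex>\<close>. Three facts make this an argument.

  First, the roots of \<open>g\<close> are finite (\<open>finite_elt_root\<close>): if \<open>s\<close> were an infinite root, then
  \<open>t = 1/s\<close> would be an infinitesimal root of the reflected polynomial
  \<open>b\<^sub>n + b\<^sub>n\<^sub>-\<^sub>1 t + \<dots> + b\<^sub>0 t\<^sup>n\<close>. Its coefficients are finite, so its value at \<open>t\<close> is infinitely
  close to \<open>b\<^sub>n\<close>, which would therefore be infinitesimal, whereas \<open>b\<^sub>n\<close> is infinitely close to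
  the nonzero standard number \<open>a\<^sub>n\<close>.

  Second, let \<open>c\<^sub>i\<close> be the standard part of \<open>s\<^sub>i\<close>. Expanding products, the coefficients of
  \<open>g = b\<^sub>n \<Prod>(z - s\<^sub>i)\<close> have as standard parts the coefficients of \<open>a\<^sub>n \<Prod>(z - c\<^sub>i)\<close>
  (\<open>coeffs_standard_part_mult\<close>, \<open>coeffs_standard_part_prod\<close>). By the hypothesis on \<open>g\<close> they also
  have as standard parts the coefficients of \<open>f\<close>.

  Third, standard parts are unique, so \<open>f = a\<^sub>n \<Prod>(z - c\<^sub>i)\<close>. Hence the \<open>c\<^sub>i\<close> list the roots of
  \<open>f\<close> with their multiplicities, and \<open>s\<^sub>i\<close> is infinitely close to \<open>c\<^sub>i\<close> by construction.
\<close>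

section \<open>Finite and infinitesimal elements\<close>

context nonstandard_complex
begin

lemma nrm_0: "nrm 0 = 0"
  by (simp only: nrm_eq_0_iff)

lemma nrm_1: "nrm 1 = 1"
  using nrm_emb[of 1] by (simp add: emb_1 remb_1)

lemma nrm_minus: "nrm (- z) = nrm z"
proof -
  have "nrm (- 1) * nrm (- 1) = 1"
    using nrm_mult[of "- 1" "- 1"] by (simp add: nrm_1)
  then have "nrm (- 1) = 1"
    using nrm_nonneg[of "- 1"] by (auto simp: square_eq_1_iff)
  then show ?thesis
    using nrm_mult[of "- 1" z] by simp
qed

lemma emb_0: "emb 0 = 0"
  using emb_add[of 0 0] by (metis add.right_neutral add_left_cancel)

lemma emb_minus: "emb (- x) = - emb x"
  using emb_add[of x "- x"] by (simp add: emb_0 eq_neg_iff_add_eq_0 add.commute)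

lemma remb_of_nat: "remb (of_nat k) = of_nat k"
proof (induction k)
  case 0
  show ?case
    using remb_add[of 0 0] by simp
qed (simp add: remb_add remb_1)

text \<open>A natural number as bound is more convenient in estimates: it is nonnegative and its
  reciprocal appears in the definition of infinitesimals.\<close>

lemma finite_elt_iff_nat: "finite_elt nrm z \<longleftrightarrow> (\<exists>k::nat. nrm z < of_nat k)"
proof
  assume "finite_elt nrm z"
  then obtain m :: int where m: "nrm z < of_int m"
    by (auto simp: finite_elt_def)
  have "(0::'b) < of_int m"
    using nrm_nonneg m by (rule le_less_trans)
  then have "nrm z < of_nat (nat m)"
    using m by simp
  then show "\<exists>k::nat. nrm z < of_nat k" ..
next
  assume "\<exists>k::nat. nrm z < of_nat k"
  then obtain k :: nat where "nrm z < of_int (int k)"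
    by auto
  then show "finite_elt nrm z"
    unfolding finite_elt_def by blast
qed

lemma finite_elt_add:
  assumes "finite_elt nrm x" "finite_elt nrm y"
  shows "finite_elt nrm (x + y)"
proof -
  obtain k l :: nat where "nrm x < of_nat k" "nrm y < of_nat l"
    using assms by (auto simp: finite_elt_iff_nat)
  then have "nrm (x + y) < of_nat (k + l)"
    using nrm_triangle[of x y] by simp
  then show ?thesis
    unfolding finite_elt_iff_nat ..
qed

lemma finite_elt_mult:
  assumes "finite_elt nrm x" "finite_elt nrm y"
  shows "finite_elt nrm (x * y)"
proof -
  obtain k l :: nat where "nrm x < of_nat k" "nrm y < of_nat l"
    using assms by (auto simp: finite_elt_iff_nat)
  then have "nrm (x * y) < of_nat (k * l)"
    using nrm_nonneg[of x] nrm_nonneg[of y] by (simp add: nrm_mult mult_strict_mono')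
  then show ?thesis
    unfolding finite_elt_iff_nat ..
qed

lemma finite_elt_emb: "finite_elt nrm (emb c)"
proof -
  obtain k :: nat where "cmod c < of_nat k"
    using reals_Archimedean2 by blast
  then have "nrm (emb c) < of_nat k"
    using strict_monoD[OF remb_strict_mono] by (metis nrm_emb remb_of_nat)
  then show ?thesis
    unfolding finite_elt_iff_nat ..
qed

lemma infinitesimal_imp_finite_elt: "infinitesimal nrm z \<Longrightarrow> finite_elt nrm z"
  unfolding infinitesimal_def finite_elt_iff_nat
  by (rule exI[of _ 1]) (metis div_by_1 of_nat_1 zero_less_one)

lemma infinitesimal_0: "infinitesimal nrm 0"
  by (simp add: infinitesimal_def nrm_0)

lemma infinitesimal_minus: "infinitesimal nrm (- z) \<longleftrightarrow> infinitesimal nrm z"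
  by (simp add: infinitesimal_def nrm_minus)

lemma infinitesimal_add:
  assumes "infinitesimal nrm x" "infinitesimal nrm y"
  shows "infinitesimal nrm (x + y)"
  unfolding infinitesimal_def
proof (intro allI impI)
  fix m :: nat assume "m > 0"
  then have "nrm x < 1 / of_nat (2 * m)" "nrm y < 1 / of_nat (2 * m)"
    using assms unfolding infinitesimal_def by (metis nat_0_less_mult_iff pos2)+
  then have "nrm x + nrm y < 1 / of_nat (2 * m) + 1 / of_nat (2 * m)"
    by (rule add_strict_mono)
  also have "\<dots> = 1 / of_nat m"
    using \<open>m > 0\<close> by (simp add: field_simps)
  finally show "nrm (x + y) < 1 / of_nat m"
    using nrm_triangle[of x y] by simp
qed

lemma infinitesimal_mult_finite_elt:
  assumes "infinitesimal nrm x" "finite_elt nrm y"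
  shows "infinitesimal nrm (x * y)"
  unfolding infinitesimal_def
proof (intro allI impI)
  fix m :: nat assume "m > 0"
  obtain k :: nat where k: "nrm y < of_nat k"
    using assms(2) by (auto simp: finite_elt_iff_nat)
  have "(0::'b) < of_nat k"
    using nrm_nonneg k by (rule le_less_trans)
  then have "k > 0"
    by simp
  then have "nrm x < 1 / of_nat (m * k)"
    using assms(1) \<open>m > 0\<close> unfolding infinitesimal_def by (metis nat_0_less_mult_iff)
  then have "nrm x * nrm y < 1 / of_nat (m * k) * of_nat k"
    using k nrm_nonneg by (intro mult_strict_mono') auto
  also have "\<dots> = 1 / of_nat m"
    using \<open>k > 0\<close> by (simp add: field_simps)
  finally show "nrm (x * y) < 1 / of_nat m"
    by (simp add: nrm_mult)
qed

lemma infinitesimal_inverse: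
  assumes "\<not> finite_elt nrm z"
  shows "infinitesimal nrm (inverse z)"
  unfolding infinitesimal_def
proof (intro allI impI)
  fix m :: nat assume "m > 0"
  have "of_nat (Suc m) \<le> nrm z"
    using assms unfolding finite_elt_iff_nat by (meson not_less)
  then have less: "of_nat m < nrm z"
    by simp
  have pos: "0 < nrm z"
    using less by (rule le_less_trans[OF of_nat_0_le_iff])
  then have "z \<noteq> 0"
    by (auto simp: nrm_0)
  then have "nrm z * nrm (inverse z) = 1"
    using nrm_mult[of z "inverse z"] by (simp add: nrm_1)
  then have "nrm (inverse z) = 1 / nrm z"
    using pos by (simp add: field_simps)
  also have "\<dots> < 1 / of_nat m"
    using less \<open>m > 0\<close> by (intro divide_strict_left_mono mult_pos_pos pos) auto
  finally show "nrm (inverse z) < 1 / of_nat m" .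
qed

section \<open>Standard parts\<close>

text \<open>
  The standard part is handled as a relation between \<open>x\<close> and \<open>c\<close>. This avoids a function with
  arbitrary values at infinite arguments: a related \<open>x\<close> is automatically finite, and the
  homomorphism laws hold without side conditions.
\<close>

abbreviation has_standard_part :: "'a \<Rightarrow> complex \<Rightarrow> bool" where
  "has_standard_part x c \<equiv> inf_close nrm x (emb c)"

lemma has_standard_part_imp_finite_elt:
  assumes "has_standard_part x c"
  shows "finite_elt nrm x"
  using finite_elt_add[OF infinitesimal_imp_finite_elt finite_elt_emb, of "x - emb c" c] assms
  by (simp add: inf_close_def)

lemma has_standard_part_unique:
  "has_standard_part x c \<Longrightarrow> has_standard_part x d \<Longrightarrow> c = d"
  using ex1_standard_part has_standard_part_imp_finite_elt by blast

lemma has_standard_part_0_iff: "has_standard_part x 0 \<longleftrightarrow> infinitesimal nrm x"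
  by (simp add: inf_close_def emb_0)

lemma has_standard_part_1: "has_standard_part 1 1"
  by (simp add: inf_close_def emb_1 infinitesimal_0)

lemma has_standard_part_minus:
  "has_standard_part x c \<Longrightarrow> has_standard_part (- x) (- c)"
  using infinitesimal_minus[of "x - emb c"] by (simp add: inf_close_def emb_minus)

lemma has_standard_part_add:
  "has_standard_part x c \<Longrightarrow> has_standard_part y d \<Longrightarrow> has_standard_part (x + y) (c + d)"
  using infinitesimal_add[of "x - emb c" "y - emb d"]
  by (simp add: inf_close_def emb_add algebra_simps)

lemma has_standard_part_mult:
  assumes "has_standard_part x c" "has_standard_part y d"
  shows "has_standard_part (x * y) (c * d)"
proof -
  have "infinitesimal nrm ((x - emb c) * y)"
    using assms has_standard_part_imp_finite_elt
    by (intro infinitesimal_mult_finite_elt) (auto simp: inf_close_def)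
  moreover have "infinitesimal nrm ((y - emb d) * emb c)"
    using assms finite_elt_emb
    by (intro infinitesimal_mult_finite_elt) (auto simp: inf_close_def)
  ultimately have "infinitesimal nrm ((x - emb c) * y + (y - emb d) * emb c)"
    by (rule infinitesimal_add)
  then show ?thesis
    by (simp add: inf_close_def emb_mult algebra_simps)
qed

lemma has_standard_part_sum:
  assumes "\<And>i. i \<in> A \<Longrightarrow> has_standard_part (x i) (c i)"
  shows "has_standard_part (\<Sum>i\<in>A. x i) (\<Sum>i\<in>A. c i)"
  using assms
  by (induction A rule: infinite_finite_induct)
    (auto simp: has_standard_part_0_iff infinitesimal_0 intro: has_standard_part_add)

section \<open>Polynomials with finite coefficients\<close>

text \<open>Both conclusions are needed at once: closeness for \<open>pCons a p\<close> uses that the value of \<open>p\<close>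
  is finite.\<close>

lemma poly_infinitesimal:
  assumes "\<And>i. finite_elt nrm (coeff p i)" "infinitesimal nrm t"
  shows "finite_elt nrm (poly p t)" "infinitesimal nrm (poly p t - coeff p 0)"
proof -
  have "finite_elt nrm (poly p t) \<and> infinitesimal nrm (poly p t - coeff p 0)"
    using assms(1)
  proof (induction p)
    case 0
    show ?case
      by (simp add: infinitesimal_0 infinitesimal_imp_finite_elt)
  next
    case (pCons a p)
    have "finite_elt nrm a" "\<And>i. finite_elt nrm (coeff p i)"
      using pCons.prems[of 0] pCons.prems[of "Suc _"] by simp_all
    then have "infinitesimal nrm (t * poly p t)"
      using pCons.IH assms(2) by (blast intro: infinitesimal_mult_finite_elt)
    then show ?case
      using \<open>finite_elt nrm a\<close>
      by (simp add: finite_elt_add infinitesimal_imp_finite_elt)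
  qed
  then show "finite_elt nrm (poly p t)" "infinitesimal nrm (poly p t - coeff p 0)"
    by auto
qed

text \<open>The reciprocal of an infinite root would be an infinitesimal root of the reflected
  polynomial, whose constant term is the leading coefficient of \<open>p\<close>.\<close>

lemma finite_elt_root:
  assumes "\<And>i. finite_elt nrm (coeff p i)" "\<not> infinitesimal nrm (lead_coeff p)"
    and "poly p s = 0"
  shows "finite_elt nrm s"
proof (rule ccontr)
  assume "\<not> finite_elt nrm s"
  then have inv: "infinitesimal nrm (inverse s)" and "s \<noteq> 0"
    using infinitesimal_inverse infinitesimal_imp_finite_elt[OF infinitesimal_0] by auto
  have "finite_elt nrm (coeff (reflect_poly p) i)" for i
    using assms(1) infinitesimal_imp_finite_elt[OF infinitesimal_0]
    by (simp add: coeff_reflect_poly)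
  then have "infinitesimal nrm (poly (reflect_poly p) (inverse s) - lead_coeff p)"
    using poly_infinitesimal(2)[OF _ inv, of "reflect_poly p"] by simp
  moreover have "poly (reflect_poly p) (inverse s) = 0"
    using \<open>s \<noteq> 0\<close> assms(3) by (simp add: poly_reflect_poly_nz)
  ultimately show False
    using assms(2) by (simp add: infinitesimal_minus)
qed

definition coeffs_standard_part :: "'a poly \<Rightarrow> complex poly \<Rightarrow> bool" where
  "coeffs_standard_part p q \<longleftrightarrow> (\<forall>i. has_standard_part (coeff p i) (coeff q i))"

lemma coeffs_standard_part_unique:
  "coeffs_standard_part p q \<Longrightarrow> coeffs_standard_part p q' \<Longrightarrow> q = q'"
  unfolding coeffs_standard_part_def poly_eq_iff by (blast intro: has_standard_part_unique)

lemma coeffs_standard_part_pCons: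
  "has_standard_part x c \<Longrightarrow> coeffs_standard_part p q \<Longrightarrow>
    coeffs_standard_part (pCons x p) (pCons c q)"
  by (simp add: coeffs_standard_part_def coeff_pCons split: nat.split)

lemma coeffs_standard_part_0: "coeffs_standard_part 0 0"
  by (simp add: coeffs_standard_part_def has_standard_part_0_iff infinitesimal_0)

lemma coeffs_standard_part_mult:
  "coeffs_standard_part p q \<Longrightarrow> coeffs_standard_part p' q' \<Longrightarrow>
    coeffs_standard_part (p * p') (q * q')"
  unfolding coeffs_standard_part_def coeff_mult
  by (blast intro: has_standard_part_sum has_standard_part_mult)

lemma coeffs_standard_part_prod:
  assumes "\<And>i. i \<in> A \<Longrightarrow> coeffs_standard_part (p i) (q i)"
  shows "coeffs_standard_part (\<Prod>i\<in>A. p i) (\<Prod>i\<in>A. q i)"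
proof -
  have "coeffs_standard_part 1 1"
    unfolding one_pCons
    by (intro coeffs_standard_part_pCons has_standard_part_1 coeffs_standard_part_0)
  then show ?thesis
    using assms
    by (induction A rule: infinite_finite_induct) (auto intro: coeffs_standard_part_mult)
qed

lemma infinitesimal_deformation_coeffs_standard_part:
  assumes "infinitesimal_deformation emb nrm g f"
  shows "coeffs_standard_part g f"
  unfolding coeffs_standard_part_def
proof
  fix i
  show "has_standard_part (coeff g i) (coeff f i)"
  proof (cases "i \<le> degree f")
    case True
    then have "infinitesimal nrm (emb (coeff f i) - coeff g i)"
      using assms by (simp add: infinitesimal_deformation_def inf_close_def)
    then show ?thesis
      using infinitesimal_minus[of "coeff g i - emb (coeff f i)"] by (simp add: inf_close_def)
  next
    case False
    then show ?thesis
      using assms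
      by (simp add: infinitesimal_deformation_def coeff_eq_0 has_standard_part_0_iff
          infinitesimal_0)
  qed
qed

end

section \<open>Alignment of the roots\<close>

lemma root_ordering_prod_linear:
  fixes r :: "nat \<Rightarrow> 'a::field"
  assumes "c \<noteq> 0"
  shows "root_ordering (smult c (\<Prod>i\<in>{1..n}. [:- r i, 1:])) (map r [1..<Suc n])"
proof -
  have "proots (\<Prod>i\<in>{1..n}. [:- r i, 1:]) = image_mset r (mset_set {1..n})"
  proof (induction n)
    case (Suc n)
    have "proots (\<Prod>i\<in>{1..Suc n}. [:- r i, 1:]) =
        proots ([:- r (Suc n), 1:] * (\<Prod>i\<in>{1..n}. [:- r i, 1:]))"
      by (subst prod.nat_ivl_Suc') simp_all
    also have "\<dots> = {#r (Suc n)#} + image_mset r (mset_set {1..n})"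
      using Suc.IH by (subst proots_mult) (simp_all del: mult_pCons_left)
    finally show ?case
      by (simp add: atLeastAtMostSuc_conv)
  qed simp
  then show ?thesis
    using assms
    by (simp add: root_ordering_def atLeastLessThanSuc_atLeastAtMost del: upt_Suc)
qed

theorem theorem1:
  fixes emb :: "complex \<Rightarrow> 'a::alg_closed_field"
    and remb :: "real \<Rightarrow> 'b::linordered_field"
    and nrm :: "'a \<Rightarrow> 'b"
    and n :: nat
    and a r :: "nat \<Rightarrow> complex" and b s :: "nat \<Rightarrow> 'a"
    and f :: "complex poly" and g :: "'a poly"
  assumes "nonstandard_complex emb remb nrm"
    and "f = (\<Sum>i\<le>n. monom (a i) i)"
    and "a n \<noteq> 0"
    and "f = smult (a n) (\<Prod>i\<in>{1..n}. [:- r i, 1:])"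
    and "g = (\<Sum>i\<le>n. monom (b i) i)"
    and "g = smult (b n) (\<Prod>i\<in>{1..n}. [:- s i, 1:])"
    and "infinitesimal_deformation emb nrm g f"
  shows "infinitesimally_aligned emb nrm g f"
proof -
  interpret nonstandard_complex emb remb nrm
    by fact
  have coeff_f: "coeff f n = a n" and coeff_g: "coeff g n = b n"
    by (simp_all add: assms(2,5) coeff_sum)
  have "degree f = n"
    using \<open>a n \<noteq> 0\<close> coeff_f le_degree[of f n]
    by (auto simp: assms(2) intro!: antisym degree_sum_le order.trans[OF degree_monom_le])
  have close: "coeffs_standard_part g f"
    using assms(7) by (rule infinitesimal_deformation_coeffs_standard_part)
  have ab: "has_standard_part (b n) (a n)"
    using close by (metis coeffs_standard_part_def coeff_f coeff_g)
  then have not_inf: "\<not> infinitesimal nrm (b n)"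
    using \<open>a n \<noteq> 0\<close> has_standard_part_unique has_standard_part_0_iff by blast
  then have "b n \<noteq> 0"
    using infinitesimal_0 by auto
  have "degree g = n"
    using assms(7) le_degree[of g n] \<open>b n \<noteq> 0\<close> \<open>degree f = n\<close> coeff_g
    by (simp add: infinitesimal_deformation_def)
  have "finite_elt nrm (s i)" if "i \<in> {1..n}" for i
  proof (rule finite_elt_root)
    show "finite_elt nrm (coeff g j)" for j
      using close has_standard_part_imp_finite_elt by (auto simp: coeffs_standard_part_def)
    show "\<not> infinitesimal nrm (lead_coeff g)"
      using not_inf \<open>degree g = n\<close> coeff_g by simp
    show "poly g (s i) = 0"
      unfolding assms(6) using that by (auto simp: poly_prod)
  qed
  then have "\<forall>i\<in>{1..n}. \<exists>c. has_standard_part (s i) c"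
    using ex1_standard_part by blast
  then obtain c where c: "\<And>i. i \<in> {1..n} \<Longrightarrow> has_standard_part (s i) (c i)"
    by metis
  have "coeffs_standard_part ([:b n:] * (\<Prod>i\<in>{1..n}. [:- s i, 1:]))
      ([:a n:] * (\<Prod>i\<in>{1..n}. [:- c i, 1:]))"
    using ab c
    by (intro coeffs_standard_part_mult coeffs_standard_part_prod coeffs_standard_part_pCons
        coeffs_standard_part_0 has_standard_part_minus has_standard_part_1)
  then have "coeffs_standard_part g (smult (a n) (\<Prod>i\<in>{1..n}. [:- c i, 1:]))"
    using assms(6) by simp
  then have "f = smult (a n) (\<Prod>i\<in>{1..n}. [:- c i, 1:])"
    using close by (blast intro: coeffs_standard_part_unique)
  then have rf: "root_ordering f (map c [1..<Suc n])"
    using root_ordering_prod_linear[OF \<open>a n \<noteq> 0\<close>] by simp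
  have rg: "root_ordering g (map s [1..<Suc n])"
    using root_ordering_prod_linear[OF \<open>b n \<noteq> 0\<close>] assms(6) by simp
  have "\<forall>i<n. inf_close nrm (map s [1..<Suc n] ! i) (emb (map c [1..<Suc n] ! i))"
    using c by (simp add: nth_map del: upt_Suc)
  then show ?thesis
    unfolding infinitesimally_aligned_def
    using rf rg assms(7) \<open>degree f = n\<close>
    by (intro conjI exI[of _ "map c [1..<Suc n]"] exI[of _ "map s [1..<Suc n]"])
      (simp_all add: infinitesimal_deformation_def del: upt_Suc)
qed

end
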